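(* Every (convex) polytope can be reconstructed from its graph together with its edge labeled vertex figures. That is: let $P$ and $P'$ be convex polytopes with vertex-edge graphs $\Gamma_P$ and $\Gamma_{P'}$, and let $\varphi:\Gamma_P\to\Gamma_{P'}$ be a graph isomorphism such that for every vertex $v$ of $P$ the induced map on edges carries the family of edge sets $\eta_v(\mathcal F(v))$ of $P$ onto the corresponding family $\eta_{\varphi(v)}(\mathcal F(\varphi(v)))$ of $P'$. Then a set $S$ of vertices of $P$ is the vertex set of a facet of $P$ if and only if $\varphi(S)$ is the vertex set of a facet of $P'$; in particular $\varphi$ induces an isomorphism of the face lattices of $P$ and $P'$.
   Context: For a polytope $P$, $\Gamma_P$ denotes its vertex-edge graph. For a vertex $v$ of $P$, $\mathcal F(v)$ is the set of facets of $P$ containing $v$, and $\Gamma_P(v)$ is the set of edges of $P$ containing $v$. The map $\eta_v$ sends a facet $F\in\mathcal F(v)$ to the set of those edges in $\Gamma_P(v)$ that are contained in $F$; so $\eta_v(\mathcal F(v))$ is a family of subsets of $\Gamma_P(v)$. The edge labeled vertex figures of $P$ are the family of images $\{\eta_v(\mathcal F(v)) : v \text{ a vertex of } P\}$. "Reconstructing" a polytope means determining its combinatorial structure (face lattice), i.e. determining which subsets of the vertex set are vertex sets of facets. *)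

theory Defs
  imports "HOL-Analysis.Polytope"
begin

definition vertices_of :: "'a::real_vector set \<Rightarrow> 'a set" where
  "vertices_of P = {v. v extreme_point_of P}"

text \<open>
  A finite simple graph is given by its vertex set and its set of edges, each edge being a
  two-element set of vertices. In the graph of a polytope, a one-dimensional face is represented
  by the set of its two end points.
\<close>

type_synonym 'a ugraph = "'a set \<times> 'a set set"

definition polytope_graph :: "'a::euclidean_space set \<Rightarrow> 'a ugraph" where
  "polytope_graph P = (vertices_of P, {vertices_of e | e. e edge_of P})"

definition graph_isomorphism :: "('a \<Rightarrow> 'b) \<Rightarrow> 'a ugraph \<Rightarrow> 'b ugraph \<Rightarrow> bool" where
  "graph_isomorphism \<phi> G H \<longleftrightarrow>
     bij_betw \<phi> (fst G) (fst H) \<and>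
     (\<forall>u\<in>fst G. \<forall>v\<in>fst G. {u, v} \<in> snd G \<longleftrightarrow> {\<phi> u, \<phi> v} \<in> snd H)"

definition facets_at :: "'a::euclidean_space set \<Rightarrow> 'a \<Rightarrow> 'a set set" where
  "facets_at P v = {F. F facet_of P \<and> v \<in> F}"

definition eta :: "'a::euclidean_space set \<Rightarrow> 'a \<Rightarrow> 'a set \<Rightarrow> 'a set set" where
  "eta P v F = {vertices_of e | e. e edge_of P \<and> v \<in> e \<and> e \<subseteq> F}"

definition edge_labeled_vertex_figure :: "'a::euclidean_space set \<Rightarrow> 'a \<Rightarrow> 'a set set set" where
  "edge_labeled_vertex_figure P v = eta P v ` facets_at P v"

text \<open>
  The face lattice consists of all faces, including the empty face and the polytope itself,
  ordered by inclusion; a lattice isomorphism is the same as an order isomorphism.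
\<close>

definition face_lattice :: "'a::real_vector set \<Rightarrow> 'a set set" where
  "face_lattice P = {F. F face_of P}"

definition face_lattice_isomorphism ::
  "('a::real_vector set \<Rightarrow> 'b::real_vector set) \<Rightarrow> 'a set \<Rightarrow> 'b set \<Rightarrow> bool" where
  "face_lattice_isomorphism \<Phi> P Q \<longleftrightarrow>
     bij_betw \<Phi> (face_lattice P) (face_lattice Q) \<and>
     (\<forall>F\<in>face_lattice P. \<forall>G\<in>face_lattice P. F \<subseteq> G \<longleftrightarrow> \<Phi> F \<subseteq> \<Phi> G)"

end

theory Submission
  imports Defs
begin

text \<open>
  The proof adapts Kalai's argument for simple polytopes. Given a real-valued function \<open>f\<close> on the vertices, call a vertex \<open>v\<close> of
  a facet \<open>F\<close> a peak of \<open>F\<close> if no edge of \<open>F\<close> at \<open>v\<close> leads to a larger value of \<open>f\<close>. Whether \<open>v\<close>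
  is a peak of \<open>F\<close> depends only on the edge set \<open>\<eta>\<^sub>v(F)\<close>, and \<open>\<eta>\<^sub>v\<close> is injective, so the graph and
  the edge labeled vertex figures determine the number of pairs \<open>(v, F)\<close> such that \<open>v\<close> is a peak of
  \<open>F\<close>. Every facet has a peak, namely a vertex that maximizes \<open>f\<close> on it. Hence this number is at
  least the number of facets, with equality iff \<open>f\<close> is one-peaked: every facet has exactly one
  peak. A generic linear functional is one-peaked, because a local maximum of a linear functional
  along the edges of a polytope is a global maximum (\<open>local_max_imp_global_max\<close>). So the minimum is
  the number of facets for both polytopes, these numbers agree, and a function is one-peaked for
  one polytope iff it is for the other.

  Now let \<open>S\<close> be the vertex set of a facet of the first polytope. A slight perturbation of an inner
  normal of this facet is a generic functional \<open>f\<close> that is smaller on \<open>S\<close> than on all other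
  vertices. Let \<open>v\<close> be the peak of \<open>S\<close>, and let \<open>T\<close> be the vertex set of the facet of the second
  polytope (with vertices identified) that has the same edges at \<open>v\<close> as \<open>S\<close>. Then \<open>v\<close> is a peak of
  \<open>T\<close>, so it is the highest vertex of \<open>T\<close>, and \<open>T\<close> lies in \<open>S\<close> because \<open>S\<close> was placed below all
  other vertices. At each vertex of \<open>T\<close> the edges in \<open>T\<close> are among the edges in \<open>S\<close>, and these form
  the edge set of another facet of the second polytope; as edge sets of distinct facets at a common
  vertex are incomparable, \<open>S\<close> and \<open>T\<close> have the same edges at each vertex of \<open>T\<close>. The graph of \<open>S\<close>
  is connected, so \<open>S = T\<close> (\<open>facets_subset_of_same_figures\<close>).

  Finally, the proper nonempty faces are intersections of facets, so the vertex sets of facets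
  determine the face lattice.
\<close>

section \<open>Graphs with a system of facets\<close>

definition star :: "'a set set \<Rightarrow> 'a \<Rightarrow> 'a set \<Rightarrow> 'a set set" where
  "star E v S = {e \<in> E. v \<in> e \<and> e \<subseteq> S}"

definition figure :: "'a set set \<Rightarrow> 'a set set \<Rightarrow> 'a \<Rightarrow> 'a set set set" where
  "figure E \<F> v = star E v ` {S \<in> \<F>. v \<in> S}"

text \<open>
  The condition is phrased through \<open>star E v S\<close> alone, so that two sets that contain
  \<open>v\<close> and have the same star there agree on whether \<open>v\<close> is a peak.
\<close>

definition peak :: "'a set set \<Rightarrow> ('a \<Rightarrow> real) \<Rightarrow> 'a set \<Rightarrow> 'a \<Rightarrow> bool" where
  "peak E f S v \<longleftrightarrow> v \<in> S \<and> (\<forall>e \<in> star E v S. \<forall>w \<in> e. f w \<le> f v)"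

definition one_peaked :: "'a set set \<Rightarrow> 'a set set \<Rightarrow> ('a \<Rightarrow> real) \<Rightarrow> bool" where
  "one_peaked E \<F> f \<longleftrightarrow> (\<forall>S\<in>\<F>. \<forall>u v. peak E f S u \<longrightarrow> peak E f S v \<longrightarrow> u = v)"

text \<open>
  These are the combinatorial properties of the facets of a polytope, given by their vertex sets,
  on which the reconstruction rests. The assumption \<open>sweep\<close> abstracts from tilting a supporting
  hyperplane of the facet \<open>S\<close> into general position.
\<close>

locale facet_system =
  fixes V :: "'a set" and E :: "'a set set" and \<F> :: "'a set set"
  assumes finite_V: "finite V"
    and facet_subset: "S \<in> \<F> \<Longrightarrow> S \<subseteq> V"
    and facet_nonempty: "S \<in> \<F> \<Longrightarrow> S \<noteq> {}"
    and star_inj: "\<lbrakk>S \<in> \<F>; T \<in> \<F>; v \<in> S; v \<in> T; star E v S \<subseteq> star E v T\<rbrakk> \<Longrightarrow> S = T"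
    and sweep: "S \<in> \<F> \<Longrightarrow>
      \<exists>f. (\<forall>x\<in>S. \<forall>y\<in>V - S. f x < f y) \<and> one_peaked E \<F> f"
begin

lemma finite_facets: "finite \<F>"
  by (rule finite_subset[of _ "Pow V"]) (use finite_V facet_subset in auto)

lemma facet_has_highest_peak:
  assumes "S \<in> \<F>"
  obtains v where "peak E f S v" "\<And>u. u \<in> S \<Longrightarrow> f u \<le> f v"
proof -
  have fin: "finite S" using assms facet_subset finite_V finite_subset by blast
  have "Max (f ` S) \<in> f ` S" using fin facet_nonempty[OF assms] by (intro Max_in) auto
  then obtain v where v: "v \<in> S" "f v = Max (f ` S)" by force
  have le: "f u \<le> f v" if "u \<in> S" for u using v fin that by simp
  have "peak E f S v" using v(1) le by (auto simp: peak_def star_def)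
  then show ?thesis using le that by blast
qed

text \<open>
  If the graph on \<open>S\<close> fell apart into \<open>U\<close> and \<open>S - U\<close>, then the highest vertex of each part would be
  a peak of \<open>S\<close>, against uniqueness of peaks for a one-peaked function.
\<close>

lemma facet_connected:
  assumes S: "S \<in> \<F>" and U: "U \<subseteq> S" "U \<noteq> {}"
    and closed: "\<And>e. \<lbrakk>e \<in> E; e \<subseteq> S; e \<inter> U \<noteq> {}\<rbrakk> \<Longrightarrow> e \<subseteq> U"
  shows "U = S"
proof (rule ccontr)
  assume "U \<noteq> S"
  obtain f where f: "one_peaked E \<F> f" using sweep[OF S] by blast
  have peak_in: "\<exists>v\<in>W. peak E f S v"
    if W: "W \<subseteq> S" "W \<noteq> {}" and cl: "\<And>e. \<lbrakk>e \<in> E; e \<subseteq> S; e \<inter> W \<noteq> {}\<rbrakk> \<Longrightarrow> e \<subseteq> W" for W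
  proof -
    have fin: "finite W" using W S facet_subset finite_V finite_subset by metis
    have "Max (f ` W) \<in> f ` W" using fin W(2) by (intro Max_in) auto
    then obtain v where v: "v \<in> W" "f v = Max (f ` W)" by force
    have le: "f u \<le> f v" if "u \<in> W" for u using v fin that by simp
    have "peak E f S v" unfolding peak_def star_def using v(1) W cl le by blast
    then show ?thesis using v(1) by blast
  qed
  obtain u where u: "u \<in> U" "peak E f S u" using peak_in[OF U closed] by blast
  have "\<exists>v\<in>S - U. peak E f S v"
    by (rule peak_in) (use U \<open>U \<noteq> S\<close> closed in blast)+
  with u f S show False unfolding one_peaked_def by blast
qed

text \<open>
  The number of pairs of a facet and a peak of it, written so that it visibly depends on the
  facets only through their figures.
\<close>

definition peak_count :: "('a \<Rightarrow> real) \<Rightarrow> nat" where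
  "peak_count f = (\<Sum>v\<in>V. card {A \<in> figure E \<F> v. \<forall>e\<in>A. \<forall>w\<in>e. f w \<le> f v})"

text \<open>
  By \<open>star_inj\<close>, counting stars at \<open>v\<close> is the same as counting facets that contain \<open>v\<close>; the rest is
  double counting.
\<close>

lemma peak_count_eq: "peak_count f = (\<Sum>S\<in>\<F>. card {v \<in> V. peak E f S v})"
proof -
  have "card {A \<in> figure E \<F> v. \<forall>e\<in>A. \<forall>w\<in>e. f w \<le> f v} = card {S \<in> \<F>. peak E f S v}" for v
  proof -
    have "card (star E v ` {S \<in> \<F>. peak E f S v}) = card {S \<in> \<F>. peak E f S v}"
    proof (rule card_image, rule inj_onI)
      fix S T assume "S \<in> {S \<in> \<F>. peak E f S v}" "T \<in> {S \<in> \<F>. peak E f S v}"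
        "star E v S = star E v T"
      then show "S = T" using star_inj[of S T v] by (simp add: peak_def)
    qed
    moreover have "star E v ` {S \<in> \<F>. peak E f S v} =
        {A \<in> figure E \<F> v. \<forall>e\<in>A. \<forall>w\<in>e. f w \<le> f v}"
      by (auto simp: peak_def figure_def)
    ultimately show ?thesis by simp
  qed
  then have "peak_count f = (\<Sum>v\<in>V. card {S \<in> \<F>. peak E f S v})"
    by (simp add: peak_count_def)
  also have "\<dots> = (\<Sum>S\<in>\<F>. card {v \<in> V. peak E f S v})"
    using sum.swap_restrict[OF finite_V finite_facets, of "\<lambda>_ _. 1::nat" "\<lambda>v S. peak E f S v"]
    by simp
  finally show ?thesis .
qed

lemma one_le_card_peaks:
  assumes "S \<in> \<F>"
  shows "1 \<le> card {v \<in> V. peak E f S v}"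
proof -
  obtain v where "peak E f S v" using facet_has_highest_peak[OF assms] by blast
  then have "{v \<in> V. peak E f S v} \<noteq> {}" using facet_subset[OF assms] by (auto simp: peak_def)
  then show ?thesis using finite_V by (simp add: Suc_leI card_gt_0_iff)
qed

lemma card_le_peak_count: "card \<F> \<le> peak_count f"
proof -
  have "(\<Sum>S\<in>\<F>. 1) \<le> (\<Sum>S\<in>\<F>. card {v \<in> V. peak E f S v})"
    by (intro sum_mono one_le_card_peaks)
  then show ?thesis by (simp add: peak_count_eq)
qed

text \<open>
  This describes one-peaked functions without reference to the individual facets, which is what
  makes them transferable between systems with the same figures.
\<close>

lemma peak_count_minimal_iff: "peak_count f = card \<F> \<longleftrightarrow> one_peaked E \<F> f"
proof -
  have "(card {v \<in> V. peak E f S v} = 1) \<longleftrightarrow> (\<forall>u v. peak E f S u \<longrightarrow> peak E f S v \<longrightarrow> u = v)"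
    if S: "S \<in> \<F>" for S
  proof
    assume "card {v \<in> V. peak E f S v} = 1"
    then obtain x where x: "{v \<in> V. peak E f S v} = {x}" by (auto simp: card_1_singleton_iff)
    have "v = x" if "peak E f S v" for v
    proof -
      have "v \<in> {v \<in> V. peak E f S v}" using that facet_subset[OF S] by (auto simp: peak_def)
      then show ?thesis unfolding x by simp
    qed
    then show "\<forall>u v. peak E f S u \<longrightarrow> peak E f S v \<longrightarrow> u = v" by blast
  next
    assume "\<forall>u v. peak E f S u \<longrightarrow> peak E f S v \<longrightarrow> u = v"
    then have "card {v \<in> V. peak E f S v} \<le> 1"
      using finite_V by (auto simp: card_le_Suc0_iff_eq)
    then show "card {v \<in> V. peak E f S v} = 1" using one_le_card_peaks[OF S, of f] by linarith
  qed
  moreover have "peak_count f = card \<F> \<longleftrightarrow> (\<forall>S\<in>\<F>. card {v \<in> V. peak E f S v} = 1)"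
  proof
    assume "peak_count f = card \<F>"
    then have "(\<Sum>S\<in>\<F>. 1) = (\<Sum>S\<in>\<F>. card {v \<in> V. peak E f S v})"
      by (simp add: peak_count_eq)
    from sum_mono_inv[OF this] show "\<forall>S\<in>\<F>. card {v \<in> V. peak E f S v} = 1"
      using one_le_card_peaks finite_facets by metis
  qed (simp add: peak_count_eq)
  ultimately show ?thesis by (simp add: one_peaked_def)
qed

end

text \<open>
  The combinatorial core. A function \<open>f\<close> that sweeps \<open>S\<close> first is one-peaked for both systems. The
  facet \<open>T\<close> of \<open>\<G>\<close> with the same star as \<open>S\<close> at the peak \<open>v\<close> of \<open>S\<close> has its maximum at \<open>v\<close>, and this
  forces it into \<open>S\<close>; connectedness of \<open>S\<close> then gives equality.
\<close>

lemma facets_subset_of_same_figures: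
  assumes "facet_system V E \<F>" and "facet_system V E \<G>"
    and fig: "\<And>v. v \<in> V \<Longrightarrow> figure E \<F> v = figure E \<G> v"
  shows "\<F> \<subseteq> \<G>"
proof
  interpret F: facet_system V E \<F> by fact
  interpret G: facet_system V E \<G> by fact
  have star_transfer: "\<exists>T\<in>\<G>. v \<in> T \<and> star E v T = star E v S" if "S \<in> \<F>" "v \<in> S" for S v
  proof -
    have "star E v S \<in> figure E \<G> v"
      using that F.facet_subset fig[of v] by (auto simp: figure_def)
    then show ?thesis by (auto simp: figure_def)
  qed
  fix S assume S: "S \<in> \<F>"
  obtain f where low: "\<And>x y. x \<in> S \<Longrightarrow> y \<in> V - S \<Longrightarrow> f x < f y" and f: "one_peaked E \<F> f"
    using F.sweep[OF S] by blast
  obtain v where v: "peak E f S v" using F.facet_has_highest_peak[OF S] by blast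
  then have vS: "v \<in> S" by (simp add: peak_def)
  obtain T where T: "T \<in> \<G>" "v \<in> T" "star E v T = star E v S"
    using star_transfer[OF S vS] by blast
  have count: "F.peak_count g = G.peak_count g" for g
    by (simp add: F.peak_count_def G.peak_count_def fig)
  \<comment> \<open>Comparing a one-peaked function of each system shows that \<open>\<F>\<close> and \<open>\<G>\<close> have equally many
    members; so \<open>f\<close> attains the minimum for \<open>\<G>\<close>, too.\<close>
  have "one_peaked E \<G> f"
  proof -
    obtain g where g: "one_peaked E \<G> g" using G.sweep[OF T(1)] by blast
    have "card \<F> \<le> card \<G>"
      using F.card_le_peak_count[of g] G.peak_count_minimal_iff[of g] g count by simp
    moreover have "card \<G> \<le> card \<F>"
      using G.card_le_peak_count[of f] F.peak_count_minimal_iff[of f] f count[of f] by simp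
    ultimately show ?thesis
      using F.peak_count_minimal_iff[of f] G.peak_count_minimal_iff[of f] f count[of f] by simp
  qed
  moreover have "peak E f T v" using v T by (simp add: peak_def)
  moreover obtain u where u: "peak E f T u" "\<And>x. x \<in> T \<Longrightarrow> f x \<le> f u"
    using G.facet_has_highest_peak[OF T(1)] by blast
  ultimately have "u = v" using T(1) by (auto simp: one_peaked_def)
  have TS: "T \<subseteq> S"
  proof
    fix x assume x: "x \<in> T"
    then have "f x \<le> f v" using u \<open>u = v\<close> by simp
    then show "x \<in> S" using low[OF vS, of x] x G.facet_subset[OF T(1)] by force
  qed
  \<comment> \<open>The star of \<open>S\<close> at \<open>x\<close> belongs to some member \<open>T'\<close> of \<open>\<G>\<close>, and by incomparability of stars
    this can only be \<open>T\<close>.\<close>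
  have same_star: "star E x S = star E x T" if x: "x \<in> T" for x
  proof -
    obtain T' where T': "T' \<in> \<G>" "x \<in> T'" "star E x T' = star E x S"
      using star_transfer[OF S] x TS by blast
    have "star E x T \<subseteq> star E x T'" using TS T'(3) by (auto simp: star_def)
    then have "T = T'" using G.star_inj T(1) T'(1,2) x by blast
    then show ?thesis using T'(3) by simp
  qed
  have "T = S"
  proof (rule F.facet_connected[OF S TS])
    show "T \<noteq> {}" using T(2) by blast
  next
    fix e assume e: "e \<in> E" "e \<subseteq> S" "e \<inter> T \<noteq> {}"
    then obtain x where x: "x \<in> e" "x \<in> T" by blast
    then have "e \<in> star E x T" using same_star e by (auto simp: star_def)
    then show "e \<subseteq> T" by (simp add: star_def)
  qed
  then show "S \<in> \<G>" using T(1) by simp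
qed

lemma inj_on_image_subset_image_iff:
  assumes "inj_on f C" "A \<subseteq> C" "B \<subseteq> C"
  shows "f ` A \<subseteq> f ` B \<longleftrightarrow> A \<subseteq> B"
proof
  assume sub: "f ` A \<subseteq> f ` B"
  show "A \<subseteq> B"
  proof
    fix x assume "x \<in> A"
    then have "f x \<in> f ` B" using sub by blast
    then show "x \<in> B" using inj_on_image_mem_iff[OF assms(1) _ assms(3)] \<open>x \<in> A\<close> assms(2) by blast
  qed
qed (rule image_mono)

lemma star_image:
  assumes "inj_on \<phi> V" "\<Union>E \<subseteq> V" "S \<subseteq> V" "v \<in> V"
  shows "star ((`) \<phi> ` E) (\<phi> v) (\<phi> ` S) = (`) \<phi> ` star E v S"
proof -
  have "\<phi> v \<in> \<phi> ` e \<longleftrightarrow> v \<in> e" "\<phi> ` e \<subseteq> \<phi> ` S \<longleftrightarrow> e \<subseteq> S" if "e \<in> E" for e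
  proof -
    have "e \<subseteq> V" using that assms(2) by blast
    then show "\<phi> v \<in> \<phi> ` e \<longleftrightarrow> v \<in> e" "\<phi> ` e \<subseteq> \<phi> ` S \<longleftrightarrow> e \<subseteq> S"
      using assms inj_on_image_mem_iff[of \<phi> V v e] inj_on_image_subset_image_iff[of \<phi> V e S]
      by simp_all
  qed
  then show ?thesis unfolding star_def by blast
qed

lemma figure_image:
  assumes "inj_on \<phi> V" "\<Union>E \<subseteq> V" "\<Union>\<F> \<subseteq> V" "v \<in> V"
  shows "figure ((`) \<phi> ` E) ((`) \<phi> ` \<F>) (\<phi> v) = (`) ((`) \<phi>) ` figure E \<F> v"
proof -
  have "{S \<in> (`) \<phi> ` \<F>. \<phi> v \<in> S} = (`) \<phi> ` {S \<in> \<F>. v \<in> S}"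
  proof -
    have "\<phi> v \<in> \<phi> ` S \<longleftrightarrow> v \<in> S" if "S \<in> \<F>" for S
      using that assms(3) inj_on_image_mem_iff[OF assms(1,4)] by blast
    then show ?thesis by blast
  qed
  moreover have "star ((`) \<phi> ` E) (\<phi> v) (\<phi> ` S) = (`) \<phi> ` star E v S" if "S \<in> \<F>" for S
  proof (rule star_image[OF assms(1,2) _ assms(4)])
    show "S \<subseteq> V" using that assms(3) by blast
  qed
  ultimately show ?thesis by (simp add: figure_def image_image)
qed

text \<open>
  Moving a system along \<open>\<phi>\<close> places the facets of both polytopes on one vertex set, where the
  combinatorial core applies. Functions are moved along the inverse of \<open>\<phi>\<close>.
\<close>

lemma facet_system_image:
  assumes "facet_system V E \<F>" and inj: "inj_on \<phi> V" and EV: "\<Union>E \<subseteq> V"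
  shows "facet_system (\<phi> ` V) ((`) \<phi> ` E) ((`) \<phi> ` \<F>)"
proof -
  interpret facet_system V E \<F> by fact
  define h where "h = inv_into V \<phi>"
  have h: "h (\<phi> v) = v" if "v \<in> V" for v using inj that by (simp add: h_def)
  have star: "star ((`) \<phi> ` E) (\<phi> v) (\<phi> ` S) = (`) \<phi> ` star E v S" if "S \<in> \<F>" "v \<in> S" for S v
    using star_image[OF inj EV] that facet_subset by blast
  show ?thesis
  proof
    show "finite (\<phi> ` V)" using finite_V by simp
  next
    fix S assume "S \<in> (`) \<phi> ` \<F>"
    then show "S \<subseteq> \<phi> ` V" "S \<noteq> {}" using facet_subset facet_nonempty by auto
  next
    fix S' T' v' assume S': "S' \<in> (`) \<phi> ` \<F>" and T': "T' \<in> (`) \<phi> ` \<F>" and v': "v' \<in> S'" "v' \<in> T'"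
      and sub: "star ((`) \<phi> ` E) v' S' \<subseteq> star ((`) \<phi> ` E) v' T'"
    obtain S T where ST: "S \<in> \<F>" "T \<in> \<F>" "S' = \<phi> ` S" "T' = \<phi> ` T" using S' T' by blast
    obtain v where v: "v \<in> S" "v' = \<phi> v" using v' ST by blast
    have vT: "v \<in> T"
      using v v'(2) ST facet_subset inj by (metis inj_on_image_mem_iff subsetD)
    have "(`) \<phi> ` star E v S \<subseteq> (`) \<phi> ` star E v T"
      using sub star[OF ST(1) v(1)] star[OF ST(2) vT] ST v by simp
    moreover have "inj_on ((`) \<phi>) (Pow V)" using inj by (rule inj_on_image_Pow)
    moreover have "star E v S \<subseteq> Pow V" "star E v T \<subseteq> Pow V" using EV by (auto simp: star_def)
    ultimately have "star E v S \<subseteq> star E v T" by (metis inj_on_image_subset_image_iff)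
    then show "S' = T'" using star_inj ST v(1) vT by blast
  next
    fix S' assume "S' \<in> (`) \<phi> ` \<F>"
    then obtain S where S: "S \<in> \<F>" "S' = \<phi> ` S" by blast
    obtain f where f: "\<And>x y. x \<in> S \<Longrightarrow> y \<in> V - S \<Longrightarrow> f x < f y" "one_peaked E \<F> f"
      using sweep[OF S(1)] by blast
    have peak: "peak E f T v" if T: "T \<in> \<F>" "v \<in> T"
      and p: "peak ((`) \<phi> ` E) (f \<circ> h) (\<phi> ` T) (\<phi> v)" for T v
    proof -
      have "f w \<le> f v" if e: "e \<in> star E v T" "w \<in> e" for e w
      proof -
        have "\<phi> ` e \<in> star ((`) \<phi> ` E) (\<phi> v) (\<phi> ` T)" using star[OF T] e by blast
        then have "(f \<circ> h) (\<phi> w) \<le> (f \<circ> h) (\<phi> v)" using p e(2) by (auto simp: peak_def)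
        moreover have "w \<in> V" "v \<in> V" using e T EV facet_subset by (auto simp: star_def)
        ultimately show ?thesis using h by simp
      qed
      then show ?thesis using T by (auto simp: peak_def)
    qed
    have "\<forall>x\<in>S'. \<forall>y\<in>\<phi> ` V - S'. (f \<circ> h) x < (f \<circ> h) y"
    proof (intro ballI)
      fix x' y' assume "x' \<in> S'" "y' \<in> \<phi> ` V - S'"
      then obtain x y where xy: "x \<in> S" "x' = \<phi> x" "y \<in> V" "y' = \<phi> y" "y \<notin> S"
        using S(2) by blast
      then have "f x < f y" using f(1) by blast
      moreover have "x \<in> V" using xy(1) facet_subset[OF S(1)] by blast
      ultimately show "(f \<circ> h) x' < (f \<circ> h) y'" using xy h by simp
    qed
    moreover have "one_peaked ((`) \<phi> ` E) ((`) \<phi> ` \<F>) (f \<circ> h)"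
      unfolding one_peaked_def
    proof (intro ballI allI impI)
      fix T' u' v' assume T': "T' \<in> (`) \<phi> ` \<F>"
        and p: "peak ((`) \<phi> ` E) (f \<circ> h) T' u'" "peak ((`) \<phi> ` E) (f \<circ> h) T' v'"
      obtain T where T: "T \<in> \<F>" "T' = \<phi> ` T" using T' by blast
      have "u' \<in> \<phi> ` T" "v' \<in> \<phi> ` T" using p T by (auto simp: peak_def)
      then obtain u v where uv: "u \<in> T" "u' = \<phi> u" "v \<in> T" "v' = \<phi> v" by blast
      have "peak E f T u" "peak E f T v" using peak p T uv by auto
      then show "u' = v'" using f(2) T(1) uv by (auto simp: one_peaked_def)
    qed
    ultimately show "\<exists>f. (\<forall>x\<in>S'. \<forall>y\<in>\<phi> ` V - S'. f x < f y)
        \<and> one_peaked ((`) \<phi> ` E) ((`) \<phi> ` \<F>) f" by blast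
  qed
qed


section \<open>Local maxima of linear functionals on polytopes\<close>

lemma polytope_eq_hull_vertices:
  fixes P :: "'a::euclidean_space set"
  assumes "polytope P"
  shows "P = convex hull (vertices_of P)"
  unfolding vertices_of_def
  using Krein_Milman_Minkowski polytope_imp_compact polytope_imp_convex assms by blast

lemma polytope_subset_iff_vertices:
  fixes P :: "'a::euclidean_space set"
  assumes "polytope P" "convex C"
  shows "P \<subseteq> C \<longleftrightarrow> vertices_of P \<subseteq> C"
proof
  show "vertices_of P \<subseteq> C \<Longrightarrow> P \<subseteq> C"
    using polytope_eq_hull_vertices[OF assms(1)] hull_minimal assms(2) by metis
qed (auto simp: vertices_of_def extreme_point_of_def)

lemma finite_vertices:
  fixes P :: "'a::euclidean_space set"
  shows "polytope P \<Longrightarrow> finite (vertices_of P)"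
  unfolding vertices_of_def by (simp add: finite_polyhedron_extreme_points polytope_imp_polyhedron)

lemma vertices_of_face: "F face_of P \<Longrightarrow> vertices_of F = vertices_of P \<inter> F"
  by (auto simp: vertices_of_def extreme_point_of_face)

text \<open>
  The face is the smallest one that contains \<open>q\<close>: a point off its relative interior lies on one of
  its facets, which would be a smaller face.
\<close>

lemma in_rel_interior_of_face:
  fixes P :: "'a::euclidean_space set"
  assumes P: "polytope P" and q: "q \<in> P"
  obtains G where "G face_of P" "q \<in> rel_interior G"
proof -
  define G where "G = \<Inter>{F. F face_of P \<and> q \<in> F}"
  have PP: "P face_of P" using P by (simp add: face_of_refl polytope_imp_convex)
  then have G: "G face_of P" unfolding G_def using q by (intro face_of_Inter) auto
  have "q \<in> rel_interior G"
  proof (rule ccontr)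
    assume "q \<notin> rel_interior G"
    moreover have "q \<in> G" by (simp add: G_def)
    moreover have "polyhedron G"
      using G P face_of_polytope_polytope polytope_imp_polyhedron by blast
    ultimately obtain F where F: "F facet_of G" "q \<in> F"
      using rel_interior_of_polyhedron[of G] by blast
    then have "F face_of P" using G face_of_trans facet_of_imp_face_of by blast
    then have "G \<subseteq> F" using F by (auto simp: G_def)
    then have "F = G" using F(1) facet_of_imp_subset by blast
    then show False using F(1) by simp
  qed
  then show ?thesis using that G by blast
qed

text \<open>
  Let \<open>G\<close> be the face with \<open>q\<close> in its relative interior. If the hyperplane met the affine hull of
  \<open>G\<close> in more than \<open>q\<close>, then \<open>q\<close> would be inside a segment of the section. So the section of the
  affine hull is a point, and \<open>G\<close> has dimension at most one; it is not a vertex, as the hyperplane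
  avoids all vertices.
\<close>

lemma hyperplane_section_vertex_on_edge:
  fixes P :: "'a::euclidean_space set"
  assumes P: "polytope P" and q: "q extreme_point_of P \<inter> {x. a \<bullet> x = \<alpha>}"
    and off: "\<And>u. u \<in> vertices_of P \<Longrightarrow> a \<bullet> u \<noteq> \<alpha>"
  obtains e where "e edge_of P" "q \<in> e"
proof -
  have qP: "q \<in> P" "a \<bullet> q = \<alpha>" using q by (auto simp: extreme_point_of_def)
  obtain G where G: "G face_of P" "q \<in> rel_interior G"
    using in_rel_interior_of_face[OF P qP(1)] by blast
  have qG: "q \<in> G" using G(2) rel_interior_subset by blast
  have cvx: "convex G" and GP: "G \<subseteq> P" using G(1) by (auto simp: face_of_imp_convex face_of_imp_subset)
  \<comment> \<open>The relative interior point \<open>q\<close> can be passed when coming from any \<open>z\<close> in the affine hull.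
    Used twice, because the first \<open>z\<close> need not lie in \<open>G\<close>.\<close>
  have beyond: "\<exists>y\<in>G. a \<bullet> y = \<alpha> \<and> y \<noteq> q \<and> q \<in> open_segment z y"
    if z: "z \<in> affine hull G" "a \<bullet> z = \<alpha>" "z \<noteq> q" for z
  proof -
    obtain t where t: "t > 1" "(1 - t) *\<^sub>R z + t *\<^sub>R q \<in> G"
      using convex_rel_interior_if2[OF cvx G(2)] z(1) by blast
    define y where "y = (1 - t) *\<^sub>R z + t *\<^sub>R q"
    have "a \<bullet> y = \<alpha>" using z(2) qP(2) by (simp add: y_def inner_add_right algebra_simps)
    have "y - q = (1 - t) *\<^sub>R (z - q)" by (simp add: y_def algebra_simps)
    then have "y \<noteq> q" using t(1) z(3) by auto
    have yz: "y - z = t *\<^sub>R (q - z)" by (simp add: y_def algebra_simps)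
    have "q = (1 - 1/t) *\<^sub>R z + (1/t) *\<^sub>R y"
    proof -
      have "(1 - 1/t) *\<^sub>R z + (1/t) *\<^sub>R y = z + (1/t) *\<^sub>R (y - z)" by (simp add: algebra_simps)
      also have "\<dots> = q" using t(1) by (simp add: yz)
      finally show ?thesis by simp
    qed
    moreover have "z \<noteq> y" using yz t(1) z(3) by auto
    moreover have "0 < 1/t" "1/t < 1" using t(1) by auto
    ultimately have "q \<in> open_segment z y" unfolding in_segment by blast
    then show ?thesis using \<open>a \<bullet> y = \<alpha>\<close> \<open>y \<noteq> q\<close> t(2) y_def by blast
  qed
  have "affine hull G \<inter> {x. a \<bullet> x = \<alpha>} = {q}"
  proof (rule ccontr)
    assume "affine hull G \<inter> {x. a \<bullet> x = \<alpha>} \<noteq> {q}"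
    moreover have "q \<in> affine hull G" using qG by (rule hull_inc)
    ultimately obtain z where z: "z \<in> affine hull G" "a \<bullet> z = \<alpha>" "z \<noteq> q" using qP(2) by blast
    obtain y where y: "y \<in> G" "a \<bullet> y = \<alpha>" "y \<noteq> q" using beyond[OF z] by blast
    obtain y' where y': "y' \<in> G" "a \<bullet> y' = \<alpha>" "q \<in> open_segment y y'"
      using beyond[OF hull_inc[OF y(1)] y(2,3)] by blast
    then show False using q y GP by (auto simp: extreme_point_of_def)
  qed
  then have "aff_dim (affine hull G \<inter> {x. a \<bullet> x = \<alpha>}) = 0"
    and "affine hull G \<inter> {x. a \<bullet> x = \<alpha>} \<noteq> {}" by auto
  then have "aff_dim G = 0 \<or> aff_dim G = 1"
    using aff_dim_affine_Int_hyperplane[OF affine_affine_hull, of G a \<alpha>]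
    by (simp split: if_splits)
  moreover have "aff_dim G \<noteq> 0"
  proof
    assume "aff_dim G = 0"
    then have "G = {q}" using qG by (auto simp: aff_dim_eq_0)
    then have "q \<in> vertices_of P" using G(1) by (simp add: vertices_of_def face_of_singleton)
    then show False using off qP(2) by blast
  qed
  ultimately show ?thesis using that[of G] G(1) qG by (simp add: edge_of_def)
qed

text \<open>
  The fact behind the simplex method. Cut \<open>P\<close> by a hyperplane that separates \<open>v\<close> from all other
  vertices. The vertices of the section lie on edges of \<open>P\<close>, and these edges contain \<open>v\<close>, as
  otherwise all their vertices would be on the far side. So \<open>c\<close> is at most \<open>c \<bullet> v\<close> on the section,
  and hence at every vertex, because the segment from \<open>v\<close> to it crosses the section.
\<close>

lemma local_max_imp_global_max:
  fixes P :: "'a::euclidean_space set"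
  assumes P: "polytope P" and v: "v \<in> vertices_of P"
    and loc: "\<And>e. \<lbrakk>e edge_of P; v \<in> e\<rbrakk> \<Longrightarrow> e \<subseteq> {x. c \<bullet> x \<le> c \<bullet> v}"
  shows "P \<subseteq> {x. c \<bullet> x \<le> c \<bullet> v}"
proof -
  have vP: "v \<in> P" using v by (auto simp: vertices_of_def extreme_point_of_def)
  have "{v} exposed_face_of P"
    using v P by (simp add: vertices_of_def exposed_face_of_polyhedron polytope_imp_polyhedron
        face_of_singleton)
  then obtain a b where ab: "P \<subseteq> {x. a \<bullet> x \<le> b}" "{v} = P \<inter> {x. a \<bullet> x = b}"
    unfolding exposed_face_of_def by blast
  have av: "a \<bullet> v = b" using ab(2) by blast
  have below: "a \<bullet> u < b" if "u \<in> vertices_of P" "u \<noteq> v" for u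
  proof -
    have "u \<in> P" using that by (auto simp: vertices_of_def extreme_point_of_def)
    then show ?thesis using ab that(2) by force
  qed
  have "\<exists>\<alpha><b. \<forall>u\<in>vertices_of P - {v}. a \<bullet> u < \<alpha>"
  proof -
    \<comment> \<open>The value \<open>b - 1\<close> keeps the set nonempty when \<open>v\<close> is the only vertex.\<close>
    define M where "M = Max (insert (b - 1) ((\<lambda>u. a \<bullet> u) ` (vertices_of P - {v})))"
    have fin: "finite ((\<lambda>u. a \<bullet> u) ` (vertices_of P - {v}))" using finite_vertices[OF P] by simp
    have "M < b" unfolding M_def using fin below by (subst Max_less_iff) auto
    moreover have "a \<bullet> u \<le> M" if "u \<in> vertices_of P - {v}" for u
      unfolding M_def using fin that by (intro Max_ge) auto
    ultimately show ?thesis by (intro exI[of _ "(M + b) / 2"]) force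
  qed
  then obtain \<alpha> where \<alpha>: "\<alpha> < b" "\<And>u. u \<in> vertices_of P \<Longrightarrow> u \<noteq> v \<Longrightarrow> a \<bullet> u < \<alpha>" by blast
  define Q where "Q = P \<inter> {x. a \<bullet> x = \<alpha>}"
  have Q: "polytope Q" unfolding Q_def
    using P polyhedron_hyperplane by (rule polytope_Int_polyhedron)
  have "c \<bullet> q \<le> c \<bullet> v" if q: "q \<in> vertices_of Q" for q
  proof -
    have off: "a \<bullet> u \<noteq> \<alpha>" if "u \<in> vertices_of P" for u using that \<alpha> av by force
    obtain e where e: "e edge_of P" "q \<in> e"
      using hyperplane_section_vertex_on_edge[OF P _ off] q unfolding Q_def vertices_of_def by blast
    have "v \<in> e"
    proof (rule ccontr)
      assume "v \<notin> e"
      have ef: "e face_of P" using e(1) by (simp add: edge_of_def)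
      have "vertices_of e \<subseteq> {x. a \<bullet> x < \<alpha>}"
        using vertices_of_face[OF ef] \<alpha>(2) \<open>v \<notin> e\<close> by blast
      then have "e \<subseteq> {x. a \<bullet> x < \<alpha>}"
        using polytope_subset_iff_vertices[OF face_of_polytope_polytope[OF P ef]
            convex_halfspace_lt] by blast
      then show False using e(2) q by (auto simp: Q_def vertices_of_def extreme_point_of_def)
    qed
    then show ?thesis using loc[OF e(1)] e(2) by blast
  qed
  then have slice: "Q \<subseteq> {x. c \<bullet> x \<le> c \<bullet> v}"
    using polytope_subset_iff_vertices[OF Q convex_halfspace_le] by blast
  have "c \<bullet> x \<le> c \<bullet> v" if x: "x \<in> vertices_of P" "x \<noteq> v" for x
  proof -
    have xP: "x \<in> P" using x by (auto simp: vertices_of_def extreme_point_of_def)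
    \<comment> \<open>\<open>t\<close> is the parameter at which the segment from \<open>v\<close> to \<open>x\<close> meets the hyperplane.\<close>
    define t where "t = (b - \<alpha>) / (b - a \<bullet> x)"
    have t: "0 < t" "t < 1" "t * (b - a \<bullet> x) = b - \<alpha>"
      using \<alpha>(1) \<alpha>(2)[OF x] by (auto simp: t_def field_simps)
    define y where "y = (1 - t) *\<^sub>R v + t *\<^sub>R x"
    have "y \<in> P" unfolding y_def
      using polytope_imp_convex[OF P] vP xP t by (auto intro: convexD_alt)
    moreover have "a \<bullet> y = \<alpha>" using t(3) by (simp add: y_def inner_add_right av algebra_simps)
    ultimately have "c \<bullet> y \<le> c \<bullet> v" using slice by (auto simp: Q_def)
    then have "t * (c \<bullet> x) \<le> t * (c \<bullet> v)" by (simp add: y_def inner_add_right algebra_simps)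
    then show ?thesis using t(1) by simp
  qed
  then have "vertices_of P \<subseteq> {x. c \<bullet> x \<le> c \<bullet> v}" by force
  then show ?thesis using polytope_subset_iff_vertices[OF P convex_halfspace_le] by blast
qed

text \<open>
  A vector that works for \<open>D\<close> is repaired for one more \<open>d\<close> by adding a small multiple of \<open>d\<close> itself.
\<close>

lemma exists_functional_nonzero_on:
  fixes D :: "'a::real_inner set"
  assumes "finite D" "0 \<notin> D"
  shows "\<exists>g. \<forall>d\<in>D. g \<bullet> d \<noteq> 0"
  using assms
proof (induction D rule: finite_induct)
  case (insert d D)
  then obtain h where h: "\<forall>x\<in>D. h \<bullet> x \<noteq> 0" by auto
  have "\<forall>\<^sub>F t in at_right (0::real). (h + t *\<^sub>R d) \<bullet> x \<noteq> 0" if "x \<in> D" for x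
  proof -
    have "((\<lambda>t. (h + t *\<^sub>R d) \<bullet> x) \<longlongrightarrow> (h + 0 *\<^sub>R d) \<bullet> x) (at_right 0)"
      by (intro tendsto_intros)
    then show ?thesis using h that by (intro tendsto_imp_eventually_ne) auto
  qed
  then have "\<forall>\<^sub>F t in at_right (0::real). \<forall>x\<in>D. (h + t *\<^sub>R d) \<bullet> x \<noteq> 0"
    using insert.hyps(1) by (simp add: eventually_ball_finite)
  moreover have "\<forall>\<^sub>F t in at_right (0::real). (h + t *\<^sub>R d) \<bullet> d \<noteq> 0"
  proof (cases "h \<bullet> d = 0")
    case True
    then show ?thesis using insert.prems
      by (auto simp: inner_add_left eventually_at_right_less intro: eventually_mono[OF eventually_at_right_less])
  next
    case False
    have "((\<lambda>t. (h + t *\<^sub>R d) \<bullet> d) \<longlongrightarrow> (h + 0 *\<^sub>R d) \<bullet> d) (at_right 0)"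
      by (intro tendsto_intros)
    then show ?thesis using False by (intro tendsto_imp_eventually_ne) auto
  qed
  ultimately have "\<forall>\<^sub>F t in at_right (0::real). \<forall>x\<in>insert d D. (h + t *\<^sub>R d) \<bullet> x \<noteq> 0"
    by eventually_elim auto
  then show ?case using eventually_happens'[OF trivial_limit_at_right_real] by blast
qed simp

text \<open>
  Applied to the differences \<open>D\<close> of vertices, this makes a functional injective on the vertices
  without reversing any strict inequality that already holds.
\<close>

lemma exists_generic_perturbation:
  fixes c :: "'a::real_inner"
  assumes "finite D" "0 \<notin> D"
  shows "\<exists>g. \<forall>d\<in>D. g \<bullet> d \<noteq> 0 \<and> (0 < c \<bullet> d \<longrightarrow> 0 < g \<bullet> d)"
proof -
  obtain h where h: "\<forall>d\<in>D. h \<bullet> d \<noteq> 0" using exists_functional_nonzero_on[OF assms] by blast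
  have "\<forall>\<^sub>F t in at_right (0::real). (c + t *\<^sub>R h) \<bullet> d \<noteq> 0 \<and> (0 < c \<bullet> d \<longrightarrow> 0 < (c + t *\<^sub>R h) \<bullet> d)"
    if d: "d \<in> D" for d
  proof -
    have lim: "((\<lambda>t. (c + t *\<^sub>R h) \<bullet> d) \<longlongrightarrow> (c + 0 *\<^sub>R h) \<bullet> d) (at_right 0)"
      by (intro tendsto_intros)
    consider "c \<bullet> d = 0" | "c \<bullet> d < 0" | "0 < c \<bullet> d" by linarith
    then show ?thesis
    proof cases
      case 1
      then show ?thesis using h d
        by (auto simp: inner_add_left intro: eventually_mono[OF eventually_at_right_less])
    next
      case 2
      then show ?thesis using order_tendstoD(2)[OF lim, of 0] by (auto elim: eventually_mono)
    next
      case 3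
      then show ?thesis using order_tendstoD(1)[OF lim, of 0] by (auto elim: eventually_mono)
    qed
  qed
  then have "\<forall>\<^sub>F t in at_right (0::real). \<forall>d\<in>D.
      (c + t *\<^sub>R h) \<bullet> d \<noteq> 0 \<and> (0 < c \<bullet> d \<longrightarrow> 0 < (c + t *\<^sub>R h) \<bullet> d)"
    using assms(1) by (simp add: eventually_ball_finite)
  then show ?thesis using eventually_happens'[OF trivial_limit_at_right_real] by blast
qed

section \<open>The facet system of a polytope\<close>

lemma face_subset_iff_vertices:
  fixes P :: "'a::euclidean_space set"
  assumes "polytope P" "F face_of P" "G face_of P"
  shows "F \<subseteq> G \<longleftrightarrow> vertices_of F \<subseteq> vertices_of G"
proof -
  have "F \<subseteq> G \<longleftrightarrow> vertices_of F \<subseteq> G"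
    using face_of_polytope_polytope[OF assms(1,2)] face_of_imp_convex[OF assms(3)]
    by (rule polytope_subset_iff_vertices)
  then show ?thesis using vertices_of_face[OF assms(2)] vertices_of_face[OF assms(3)] by blast
qed

abbreviation edge_sets :: "'a::euclidean_space set \<Rightarrow> 'a set set" where
  "edge_sets P \<equiv> snd (polytope_graph P)"

abbreviation facet_sets :: "'a::euclidean_space set \<Rightarrow> 'a set set" where
  "facet_sets P \<equiv> vertices_of ` {F. F facet_of P}"

lemma eta_eq_star:
  fixes P :: "'a::euclidean_space set"
  assumes "polytope P" "F face_of P" "v \<in> vertices_of P"
  shows "eta P v F = star (edge_sets P) v (vertices_of F)"
proof -
  have "v \<in> e \<and> e \<subseteq> F \<longleftrightarrow> v \<in> vertices_of e \<and> vertices_of e \<subseteq> vertices_of F" if "e edge_of P" for e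
    using that assms face_subset_iff_vertices[of P e F] vertices_of_face[of e P]
    by (auto simp: edge_of_def)
  then show ?thesis by (auto simp: eta_def star_def polytope_graph_def)
qed

lemma edge_labeled_vertex_figure_eq:
  fixes P :: "'a::euclidean_space set"
  assumes "polytope P" "v \<in> vertices_of P"
  shows "edge_labeled_vertex_figure P v = figure (edge_sets P) (facet_sets P) v"
proof -
  have "v \<in> vertices_of F \<longleftrightarrow> v \<in> F" if "F facet_of P" for F
    using vertices_of_face[OF facet_of_imp_face_of[OF that]] assms(2) by blast
  then have "{S \<in> facet_sets P. v \<in> S} = vertices_of ` facets_at P v"
    by (auto simp: facets_at_def)
  moreover have "eta P v F = star (edge_sets P) v (vertices_of F)" if "F \<in> facets_at P v" for F
    using eta_eq_star[OF assms(1) _ assms(2)] that by (simp add: facets_at_def facet_of_imp_face_of)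
  ultimately show ?thesis by (simp add: edge_labeled_vertex_figure_def figure_def image_image)
qed

text \<open>
  The edges of the face \<open>F\<close> are edges of \<open>P\<close>, so a peak is a local maximum along the edges of the
  polytope \<open>F\<close>.
\<close>

lemma peak_maximizes_on_face:
  fixes P :: "'a::euclidean_space set"
  assumes P: "polytope P" and F: "F face_of P"
    and peak: "peak (edge_sets P) (\<lambda>x. c \<bullet> x) (vertices_of F) v"
  shows "F \<subseteq> {x. c \<bullet> x \<le> c \<bullet> v}"
proof (rule local_max_imp_global_max)
  show pF: "polytope F" using P F face_of_polytope_polytope by blast
  show vF: "v \<in> vertices_of F" using peak by (simp add: peak_def)
  fix e assume e: "e edge_of F" "v \<in> e"
  have eF: "e face_of F" using e by (simp add: edge_of_def)
  have eP: "e edge_of P" using e F face_of_trans by (auto simp: edge_of_def)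
  have "vertices_of e \<in> star (edge_sets P) v (vertices_of F)"
    using eP e vF vertices_of_face[OF eF] by (auto simp: star_def polytope_graph_def)
  then have "vertices_of e \<subseteq> {x. c \<bullet> x \<le> c \<bullet> v}" using peak by (auto simp: peak_def)
  then show "e \<subseteq> {x. c \<bullet> x \<le> c \<bullet> v}"
    using polytope_subset_iff_vertices[OF face_of_polytope_polytope[OF pF eF] convex_halfspace_le]
    by blast
qed

text \<open>
  Let \<open>a\<close> be an outer normal of \<open>G\<close>. All edges of \<open>F\<close> at \<open>v\<close> lie in \<open>G\<close>, where \<open>a\<close> is constant, so \<open>v\<close>
  is a local maximum of \<open>- a\<close> on \<open>F\<close>. It is then a global one, so \<open>a\<close> attains its maximum over \<open>P\<close>
  on all of \<open>F\<close>, which gives \<open>F \<subseteq> G\<close>; facets have equal dimension.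
\<close>

lemma facet_eq_of_star_subset:
  fixes P :: "'a::euclidean_space set"
  assumes P: "polytope P" and F: "F facet_of P" and G: "G facet_of P"
    and v: "v \<in> vertices_of F" "v \<in> vertices_of G"
    and sub: "star (edge_sets P) v (vertices_of F) \<subseteq> star (edge_sets P) v (vertices_of G)"
  shows "F = G"
proof -
  note Ff = facet_of_imp_face_of[OF F] and Gf = facet_of_imp_face_of[OF G]
  obtain a b where ab: "P \<subseteq> {x. a \<bullet> x \<le> b}" "G = P \<inter> {x. a \<bullet> x = b}"
    using facet_of_polyhedron[OF polytope_imp_polyhedron[OF P] G] by blast
  have VG: "vertices_of G \<subseteq> G" by (auto simp: vertices_of_def extreme_point_of_def)
  have "peak (edge_sets P) (\<lambda>x. (- a) \<bullet> x) (vertices_of F) v"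
    unfolding peak_def
  proof (intro conjI ballI)
    fix e w assume "e \<in> star (edge_sets P) v (vertices_of F)" "w \<in> e"
    then have "w \<in> G" "v \<in> G" using sub v(2) VG by (auto simp: star_def)
    then show "(- a) \<bullet> w \<le> (- a) \<bullet> v" using ab(2) by auto
  qed (rule v(1))
  then have "F \<subseteq> {x. (- a) \<bullet> x \<le> (- a) \<bullet> v}" by (rule peak_maximizes_on_face[OF P Ff])
  moreover have "a \<bullet> v = b" using v(2) VG ab(2) by blast
  ultimately have FG: "F \<subseteq> G" using ab face_of_imp_subset[OF Ff] by fastforce
  then have "F face_of G"
    using Ff Gf face_of_face by blast
  moreover have "aff_dim F = aff_dim G" using F G by (simp add: facet_of_def)
  ultimately show "F = G"
    using face_of_aff_dim_lt[of G F] face_of_imp_convex[OF Gf] by force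
qed

text \<open>
  The sweeping function for a facet is a generic perturbation of its inner normal \<open>- a\<close>. Two peaks
  of a facet both maximize it, so they have the same value and agree by genericity.
\<close>

lemma facet_system_polytope:
  fixes P :: "'a::euclidean_space set"
  assumes P: "polytope P"
  shows "facet_system (vertices_of P) (edge_sets P) (facet_sets P)"
proof
  show "finite (vertices_of P)" using P by (rule finite_vertices)
next
  fix S assume "S \<in> facet_sets P"
  then obtain F where F: "F facet_of P" "S = vertices_of F" by blast
  note Ff = facet_of_imp_face_of[OF F(1)]
  show "S \<subseteq> vertices_of P" using F vertices_of_face[OF Ff] by blast
  have "F = convex hull S"
    using polytope_eq_hull_vertices face_of_polytope_polytope[OF P Ff] F(2) by blast
  then show "S \<noteq> {}" using F(1) by (auto simp: facet_of_def)
  obtain a b where ab: "P \<subseteq> {x. a \<bullet> x \<le> b}" "F = P \<inter> {x. a \<bullet> x = b}"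
    using facet_of_polyhedron[OF polytope_imp_polyhedron[OF P] F(1)] by blast
  define D where "D = (\<lambda>(x, y). y - x) ` (vertices_of P \<times> vertices_of P) - {0}"
  have "finite D" "0 \<notin> D" using finite_vertices[OF P] by (auto simp: D_def)
  from exists_generic_perturbation[OF this, of "- a"] obtain g
    where g: "\<And>d. d \<in> D \<Longrightarrow> g \<bullet> d \<noteq> 0" "\<And>d. d \<in> D \<Longrightarrow> a \<bullet> d < 0 \<Longrightarrow> 0 < g \<bullet> d"
    by auto
  have D: "y - x \<in> D" if "x \<in> vertices_of P" "y \<in> vertices_of P" "x \<noteq> y" for x y
    using that by (force simp: D_def)
  have "g \<bullet> x < g \<bullet> y" if x: "x \<in> S" and y: "y \<in> vertices_of P - S" for x y
  proof -
    have xV: "x \<in> vertices_of P" "x \<in> F" using x F(2) vertices_of_face[OF Ff] by auto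
    have "y \<in> P" using y by (auto simp: vertices_of_def extreme_point_of_def)
    moreover have "y \<notin> F" using y F(2) vertices_of_face[OF Ff] by blast
    ultimately have yV: "y \<in> P" "y \<notin> F" by auto
    have "a \<bullet> (y - x) < 0" using ab xV(2) yV by (force simp: inner_diff_right)
    then have "0 < g \<bullet> (y - x)" using g(2) D[OF xV(1), of y] x y by blast
    then show ?thesis by (simp add: inner_diff_right)
  qed
  moreover have "one_peaked (edge_sets P) (facet_sets P) (\<lambda>x. g \<bullet> x)"
    unfolding one_peaked_def
  proof (intro ballI allI impI)
    fix T u v assume T: "T \<in> facet_sets P"
      and peak: "peak (edge_sets P) (\<lambda>x. g \<bullet> x) T u" "peak (edge_sets P) (\<lambda>x. g \<bullet> x) T v"
    obtain G where G: "G facet_of P" "T = vertices_of G" using T by blast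
    note Gf = facet_of_imp_face_of[OF G(1)]
    have uv: "u \<in> vertices_of P" "u \<in> G" "v \<in> vertices_of P" "v \<in> G"
      using peak G(2) vertices_of_face[OF Gf] by (auto simp: peak_def)
    have "g \<bullet> u = g \<bullet> v"
      using peak_maximizes_on_face[OF P Gf] peak G(2) uv by (intro antisym) blast+
    then show "u = v" using g(1) D[OF uv(1,3)] by (force simp: inner_diff_right)
  qed
  ultimately show "\<exists>f. (\<forall>x\<in>S. \<forall>y\<in>vertices_of P - S. f x < f y)
      \<and> one_peaked (edge_sets P) (facet_sets P) f" by blast
next
  fix S T v assume "S \<in> facet_sets P" "T \<in> facet_sets P" "v \<in> S" "v \<in> T"
    "star (edge_sets P) v S \<subseteq> star (edge_sets P) v T"
  then show "S = T" using facet_eq_of_star_subset[OF P] by blast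
qed

section \<open>Reconstruction\<close>

text \<open>
  A graph isomorphism speaks about unordered pairs of vertices; this makes it a statement about
  the edge sets themselves.
\<close>

lemma edge_set_is_pair:
  fixes P :: "'a::euclidean_space set"
  assumes P: "polytope P" and A: "A \<in> edge_sets P"
  obtains u v where "A = {u, v}" "u \<in> vertices_of P" "v \<in> vertices_of P"
proof -
  obtain e where e: "e edge_of P" "A = vertices_of e" using A by (auto simp: polytope_graph_def)
  have ef: "e face_of P" and dim: "aff_dim e = 1" using e(1) by (auto simp: edge_of_def)
  have "e \<noteq> {}" using dim by auto
  moreover have "collinear e" using dim by (simp add: collinear_aff_dim)
  moreover have "compact e" "convex e"
    using face_of_polytope_polytope[OF P ef] by (auto simp: polytope_imp_compact polytope_imp_convex)
  ultimately obtain u v where "e = closed_segment u v"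
    using compact_convex_collinear_segment by blast
  then have "A = {u, v}" using e(2) by (auto simp: vertices_of_def extreme_point_of_segment)
  moreover have "A \<subseteq> vertices_of P" using vertices_of_face[OF ef] e(2) by blast
  ultimately show ?thesis using that by blast
qed

lemma edge_sets_image:
  fixes P :: "'a::euclidean_space set" and P' :: "'b::euclidean_space set"
  assumes "polytope P" "polytope P'"
    and iso: "graph_isomorphism \<phi> (polytope_graph P) (polytope_graph P')"
  shows "edge_sets P' = (`) \<phi> ` edge_sets P"
proof -
  have bij: "\<phi> ` vertices_of P = vertices_of P'"
    using iso by (simp add: graph_isomorphism_def polytope_graph_def bij_betw_def)
  have adj: "{u, v} \<in> edge_sets P \<longleftrightarrow> {\<phi> u, \<phi> v} \<in> edge_sets P'"
    if "u \<in> vertices_of P" "v \<in> vertices_of P" for u v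
    using iso that by (simp add: graph_isomorphism_def polytope_graph_def)
  show ?thesis
  proof (intro equalityI subsetI)
    fix A' assume A': "A' \<in> edge_sets P'"
    obtain u' v' where "A' = {u', v'}" "u' \<in> vertices_of P'" "v' \<in> vertices_of P'"
      using edge_set_is_pair[OF assms(2) A'] by blast
    then obtain u v where uv: "A' = {\<phi> u, \<phi> v}" "u \<in> vertices_of P" "v \<in> vertices_of P"
      unfolding bij[symmetric] by blast
    then have "{u, v} \<in> edge_sets P" using adj A' by blast
    moreover have "A' = \<phi> ` {u, v}" using uv by simp
    ultimately show "A' \<in> (`) \<phi> ` edge_sets P" by blast
  next
    fix A' assume "A' \<in> (`) \<phi> ` edge_sets P"
    then obtain A where A: "A \<in> edge_sets P" "A' = \<phi> ` A" by blast
    obtain u v where "A = {u, v}" "u \<in> vertices_of P" "v \<in> vertices_of P"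
      using edge_set_is_pair[OF assms(1) A(1)] by blast
    then show "A' \<in> edge_sets P'" using adj A by simp
  qed
qed

lemma facet_sets_image:
  fixes P :: "'a::euclidean_space set" and P' :: "'b::euclidean_space set"
  assumes P: "polytope P" and P': "polytope P'"
    and iso: "graph_isomorphism \<phi> (polytope_graph P) (polytope_graph P')"
    and fig: "\<And>v. v \<in> vertices_of P \<Longrightarrow>
           (\<lambda>A. (\<lambda>e. \<phi> ` e) ` A) ` edge_labeled_vertex_figure P v
             = edge_labeled_vertex_figure P' (\<phi> v)"
  shows "facet_sets P' = (`) \<phi> ` facet_sets P"
proof -
  let ?V = "vertices_of P" and ?E = "edge_sets P" and ?F = "facet_sets P"
  have inj: "inj_on \<phi> ?V" and img: "\<phi> ` ?V = vertices_of P'"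
    using iso by (auto simp: graph_isomorphism_def polytope_graph_def bij_betw_def)
  have EV: "\<Union>?E \<subseteq> ?V" using edge_set_is_pair[OF P] by blast
  have FV: "\<Union>?F \<subseteq> ?V" using vertices_of_face facet_of_imp_face_of by blast
  have E': "edge_sets P' = (`) \<phi> ` ?E" using edge_sets_image[OF P P' iso] .
  have sys: "facet_system (vertices_of P') (edge_sets P') ((`) \<phi> ` ?F)"
    using facet_system_image[OF facet_system_polytope[OF P] inj EV] by (simp add: img E')
  have sys': "facet_system (vertices_of P') (edge_sets P') (facet_sets P')"
    by (rule facet_system_polytope[OF P'])
  have "figure (edge_sets P') ((`) \<phi> ` ?F) v' = figure (edge_sets P') (facet_sets P') v'"
    if v': "v' \<in> vertices_of P'" for v'
  proof -
    obtain v where v: "v \<in> ?V" "v' = \<phi> v" using v' img by blast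
    have "figure (edge_sets P') ((`) \<phi> ` ?F) v' = (`) ((`) \<phi>) ` figure ?E ?F v"
      using figure_image[OF inj EV FV v(1)] E' v(2) by simp
    also have "\<dots> = edge_labeled_vertex_figure P' v'"
      using fig[OF v(1)] edge_labeled_vertex_figure_eq[OF P v(1)] v(2) by simp
    also have "\<dots> = figure (edge_sets P') (facet_sets P') v'"
      using edge_labeled_vertex_figure_eq[OF P' v'] .
    finally show ?thesis .
  qed
  then show ?thesis
    using facets_subset_of_same_figures[OF sys sys'] facets_subset_of_same_figures[OF sys' sys]
    by (metis subset_antisym)
qed

text \<open>
  Proper nonempty faces are intersections of facets, and taking vertices commutes with
  intersections of faces. The empty face is listed separately, because it need not be an
  intersection of facets: a point has no facets, for instance.
\<close>

lemma face_vertex_sets: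
  fixes P :: "'a::euclidean_space set"
  assumes P: "polytope P"
  shows "vertices_of ` face_lattice P =
    {{}, vertices_of P} \<union> {\<Inter>\<A> | \<A>. \<A> \<noteq> {} \<and> \<A> \<subseteq> facet_sets P}"
proof (intro equalityI subsetI)
  fix S assume "S \<in> vertices_of ` face_lattice P"
  then obtain C where C: "C face_of P" "S = vertices_of C" by (auto simp: face_lattice_def)
  show "S \<in> {{}, vertices_of P} \<union> {\<Inter>\<A> | \<A>. \<A> \<noteq> {} \<and> \<A> \<subseteq> facet_sets P}"
  proof (cases "C = {} \<or> C = P")
    case True
    then show ?thesis using C by (auto simp: vertices_of_def)
  next
    case False
    define \<B> where "\<B> = {F. F facet_of P \<and> C \<subseteq> F}"
    have "C = \<Inter>\<B>" unfolding \<B>_def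
      using face_of_polyhedron polytope_imp_polyhedron[OF P] C(1) False by blast
    moreover have "\<B> \<noteq> {}" unfolding \<B>_def
      using face_of_polyhedron_subset_facet polytope_imp_polyhedron[OF P] C(1) False by blast
    moreover have "vertices_of F = vertices_of P \<inter> F" if "F \<in> \<B>" for F
      using that vertices_of_face facet_of_imp_face_of by (auto simp: \<B>_def)
    ultimately have "S = \<Inter>(vertices_of ` \<B>)" using C vertices_of_face[OF C(1)] by auto
    moreover have "vertices_of ` \<B> \<noteq> {}" "vertices_of ` \<B> \<subseteq> facet_sets P"
      using \<open>\<B> \<noteq> {}\<close> by (auto simp: \<B>_def)
    ultimately show ?thesis by blast
  qed
next
  fix S assume "S \<in> {{}, vertices_of P} \<union> {\<Inter>\<A> | \<A>. \<A> \<noteq> {} \<and> \<A> \<subseteq> facet_sets P}"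
  then consider "S = {}" | "S = vertices_of P"
    | \<A> where "S = \<Inter>\<A>" "\<A> \<noteq> {}" "\<A> \<subseteq> facet_sets P" by blast
  then show "S \<in> vertices_of ` face_lattice P"
  proof cases
    case 1
    then have "S = vertices_of {}" by (simp add: vertices_of_def)
    then show ?thesis by (auto simp: face_lattice_def)
  next
    case 2
    then show ?thesis using P by (auto simp: face_lattice_def face_of_refl polytope_imp_convex)
  next
    case 3
    then obtain \<B> where B: "\<B> \<subseteq> {F. F facet_of P}" "\<A> = vertices_of ` \<B>"
      by (meson subset_imageE)
    have "\<B> \<noteq> {}" using B 3 by blast
    then have face: "\<Inter>\<B> face_of P" using B(1) facet_of_imp_face_of by (intro face_of_Inter) auto
    have "vertices_of F = vertices_of P \<inter> F" if "F \<in> \<B>" for F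
      using that B(1) vertices_of_face facet_of_imp_face_of by blast
    then have "S = vertices_of (\<Inter>\<B>)"
      using 3 B vertices_of_face[OF face] \<open>\<B> \<noteq> {}\<close> by auto
    then show ?thesis using face by (auto simp: face_lattice_def)
  qed
qed

text \<open>
  Inclusion of faces is inclusion of their vertex sets, so a bijection of vertices that matches
  the vertex sets of faces lifts to the face lattices.
\<close>

lemma face_lattice_isomorphismI:
  fixes P :: "'a::euclidean_space set" and P' :: "'b::euclidean_space set"
  assumes P: "polytope P" and P': "polytope P'" and inj: "inj_on \<phi> (vertices_of P)"
    and img: "vertices_of ` face_lattice P' = (`) \<phi> ` vertices_of ` face_lattice P"
  shows "\<exists>\<Phi>. face_lattice_isomorphism \<Phi> P P' \<and>
            (\<forall>F\<in>face_lattice P. vertices_of (\<Phi> F) = \<phi> ` vertices_of F)"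
proof -
  have "\<forall>F\<in>face_lattice P. \<exists>G. G \<in> face_lattice P' \<and> vertices_of G = \<phi> ` vertices_of F"
    using img by (metis imageE imageI)
  then obtain \<Phi> where \<Phi>: "\<And>F. F \<in> face_lattice P \<Longrightarrow> \<Phi> F \<in> face_lattice P'"
      "\<And>F. F \<in> face_lattice P \<Longrightarrow> vertices_of (\<Phi> F) = \<phi> ` vertices_of F"
    by metis
  have mono: "F \<subseteq> G \<longleftrightarrow> \<Phi> F \<subseteq> \<Phi> G" if FG: "F \<in> face_lattice P" "G \<in> face_lattice P" for F G
  proof -
    have "vertices_of F \<subseteq> vertices_of P" "vertices_of G \<subseteq> vertices_of P"
      using FG vertices_of_face by (auto simp: face_lattice_def)
    then have "vertices_of F \<subseteq> vertices_of G \<longleftrightarrow> \<phi> ` vertices_of F \<subseteq> \<phi> ` vertices_of G"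
      using inj_on_image_subset_image_iff[OF inj] by blast
    then show ?thesis
      using face_subset_iff_vertices[OF P] face_subset_iff_vertices[OF P'] \<Phi> FG
      by (simp add: face_lattice_def)
  qed
  have "bij_betw \<Phi> (face_lattice P) (face_lattice P')"
  proof (rule bij_betw_imageI)
    show "inj_on \<Phi> (face_lattice P)" using mono by (intro inj_onI) blast
    show "\<Phi> ` face_lattice P = face_lattice P'"
    proof (intro equalityI subsetI)
      fix G assume G: "G \<in> face_lattice P'"
      then have "vertices_of G \<in> (`) \<phi> ` vertices_of ` face_lattice P"
        unfolding img[symmetric] by (rule imageI)
      then obtain F where F: "F \<in> face_lattice P" "vertices_of G = \<phi> ` vertices_of F"
        by (elim imageE) simp
      then have "vertices_of G = vertices_of (\<Phi> F)" using \<Phi>(2) by simp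
      then have "G = \<Phi> F"
        using face_subset_iff_vertices[OF P'] G \<Phi>(1)[OF F(1)]
        by (simp add: face_lattice_def set_eq_subset)
      then show "G \<in> \<Phi> ` face_lattice P" using F(1) by blast
    qed (use \<Phi>(1) in blast)
  qed
  then show ?thesis using mono \<Phi>(2) unfolding face_lattice_isomorphism_def by blast
qed

theorem theorem2p3:
  fixes P :: "'a::euclidean_space set" and P' :: "'b::euclidean_space set"
    and \<phi> :: "'a \<Rightarrow> 'b"
  assumes "polytope P" and "polytope P'"
    and "graph_isomorphism \<phi> (polytope_graph P) (polytope_graph P')"
    and "\<And>v. v \<in> vertices_of P \<Longrightarrow>
           (\<lambda>A. (\<lambda>e. \<phi> ` e) ` A) ` edge_labeled_vertex_figure P v
             = edge_labeled_vertex_figure P' (\<phi> v)"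
  shows "(\<forall>S. S \<subseteq> vertices_of P \<longrightarrow>
            ((\<exists>F. F facet_of P \<and> vertices_of F = S) \<longleftrightarrow>
             (\<exists>F'. F' facet_of P' \<and> vertices_of F' = \<phi> ` S))) \<and>
         (\<exists>\<Phi>. face_lattice_isomorphism \<Phi> P P' \<and>
            (\<forall>F\<in>face_lattice P. vertices_of (\<Phi> F) = \<phi> ` vertices_of F))"
proof
  have facets: "facet_sets P' = (`) \<phi> ` facet_sets P" using facet_sets_image[OF assms] .
  have inj: "inj_on \<phi> (vertices_of P)" and img: "\<phi> ` vertices_of P = vertices_of P'"
    using assms(3) by (auto simp: graph_isomorphism_def polytope_graph_def bij_betw_def)
  have FV: "S \<subseteq> vertices_of P" if "S \<in> facet_sets P" for S
    using that vertices_of_face facet_of_imp_face_of by blast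
  have "S \<in> facet_sets P \<longleftrightarrow> \<phi> ` S \<in> facet_sets P'" if S: "S \<subseteq> vertices_of P" for S
  proof
    assume "\<phi> ` S \<in> facet_sets P'"
    then obtain T where T: "T \<in> facet_sets P" "\<phi> ` S = \<phi> ` T" unfolding facets by (rule imageE)
    then have "S = T" using inj_on_image_eq_iff[OF inj S FV] by simp
    then show "S \<in> facet_sets P" using T(1) by simp
  qed (simp only: facets imageI)
  then show "\<forall>S. S \<subseteq> vertices_of P \<longrightarrow>
            ((\<exists>F. F facet_of P \<and> vertices_of F = S) \<longleftrightarrow>
             (\<exists>F'. F' facet_of P' \<and> vertices_of F' = \<phi> ` S))"
    by (auto simp: image_iff) metis+
  have inter: "\<phi> ` \<Inter>\<A> = \<Inter>((`) \<phi> ` \<A>)" if "\<A> \<noteq> {}" "\<A> \<subseteq> facet_sets P" for \<A>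
  proof -
    obtain A where "A \<in> \<A>" using \<open>\<A> \<noteq> {}\<close> by blast
    then show ?thesis using image_INT[OF inj, of \<A> id A] that FV by auto
  qed
  have "{\<Inter>\<A> | \<A>. \<A> \<noteq> {} \<and> \<A> \<subseteq> facet_sets P'}
      = (`) \<phi> ` {\<Inter>\<A> | \<A>. \<A> \<noteq> {} \<and> \<A> \<subseteq> facet_sets P}"
  proof (intro equalityI subsetI)
    fix S' assume "S' \<in> {\<Inter>\<A> | \<A>. \<A> \<noteq> {} \<and> \<A> \<subseteq> facet_sets P'}"
    then obtain \<A>' where A': "S' = \<Inter>\<A>'" "\<A>' \<noteq> {}" "\<A>' \<subseteq> (`) \<phi> ` facet_sets P"
      using facets by auto
    then obtain \<A> where "\<A> \<subseteq> facet_sets P" "\<A>' = (`) \<phi> ` \<A>" by (meson subset_imageE)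
    moreover have "\<A> \<noteq> {}" using A'(2) calculation(2) by blast
    ultimately show "S' \<in> (`) \<phi> ` {\<Inter>\<A> | \<A>. \<A> \<noteq> {} \<and> \<A> \<subseteq> facet_sets P}"
      using inter A'(1) by blast
  next
    fix S' assume "S' \<in> (`) \<phi> ` {\<Inter>\<A> | \<A>. \<A> \<noteq> {} \<and> \<A> \<subseteq> facet_sets P}"
    then obtain \<A> where A: "S' = \<phi> ` \<Inter>\<A>" "\<A> \<noteq> {}" "\<A> \<subseteq> facet_sets P" by blast
    then have "S' = \<Inter>((`) \<phi> ` \<A>)" "(`) \<phi> ` \<A> \<noteq> {}" "(`) \<phi> ` \<A> \<subseteq> facet_sets P'"
      using inter facets by auto
    then show "S' \<in> {\<Inter>\<A> | \<A>. \<A> \<noteq> {} \<and> \<A> \<subseteq> facet_sets P'}" by blast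
  qed
  then have "vertices_of ` face_lattice P' = (`) \<phi> ` vertices_of ` face_lattice P"
    using face_vertex_sets[OF assms(1)] face_vertex_sets[OF assms(2)] img
    by (simp add: image_Un)
  then show "\<exists>\<Phi>. face_lattice_isomorphism \<Phi> P P' \<and>
            (\<forall>F\<in>face_lattice P. vertices_of (\<Phi> F) = \<phi> ` vertices_of F)"
    by (rule face_lattice_isomorphismI[OF assms(1,2) inj])
qed

end
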